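(* Assume $z\ne0$ and $b\notin\mathbb{Z}$. For integers $m\ge0$ put $$A_m=\Gamma(m+1)\,\Gamma(2-b+m)\,\Gamma(a+m+1),\qquad B_m=z^{-b}\,\Gamma(a-b+1+m)\,\Gamma(b+1+m)\,\Gamma(m+2),$$ $$u_m=\frac{A_m-B_m}{b},\qquad v_m=\Gamma(m+2)\,\Gamma(b+m+1)\,\Gamma(2-b+m),\qquad w_m=\frac{u_m}{v_m}.$$ Then: (i) $$U(a,b,z)=\frac{\Gamma(1-b)}{\Gamma(a-b+1)}+\frac{\pi b\,z}{\sin(\pi b)\,\Gamma(a)\,\Gamma(a-b+1)}\sum_{m=0}^\infty w_m\frac{z^m}{m!},$$ and the $u_m$ are well defined in the limit $b\to0$. (ii) For $m\ge0$, $$u_{m+1}=\frac{a_mA_m-b_mB_m}{b}=a_mu_m+d_mB_m,\qquad d_m=\frac{a_m-b_m}{b},$$ where $$a_m=c_m-\bigl(m^2+(a+2)m+a+1\bigr)b,\qquad b_m=c_m+(m+2)(a-b)b,$$ $$c_m=(m+1)(m+2)(m+a+1),\qquad d_m=-\bigl(m^2+2m(a+1)+3a+1\bigr)+(m+2)b.$$ The starting value for the $v_m$ is $$v_0=\Gamma(b+1)\Gamma(2-b)=\frac{(1-b)\,\pi b}{\sin(\pi b)}.$$ (iii) The derivative of $U$ with respect to $z$ is $$U'(a,b,z)=\frac{\pi b}{\sin(\pi b)\,\Gamma(a)\,\Gamma(a-b+1)}\sum_{m=0}^\infty w_m^d\,\frac{z^m}{m!},\qquad w_m^d=(m+1)w_m+z\,w_m',$$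 where $w_m'=u_m'/v_m$ is obtained from $$u_m'=\frac1z\,B_m.$$
   Context: $U(a,b,z)$ denotes the Kummer confluent hypergeometric function of the second kind. For $b\notin\mathbb{Z}$ it is represented by $$U(a,b,z)=\frac{\Gamma(1-b)}{\Gamma(a-b+1)}\,{}_1F_1(a;b;z)+\frac{z^{1-b}\,\Gamma(b-1)}{\Gamma(a)}\,{}_1F_1(a-b+1;2-b;z),$$ where ${}_1F_1(\alpha;\beta;z)=\sum_{m\ge0}\frac{(\alpha)_m}{(\beta)_m}\frac{z^m}{m!}$ and $(\alpha)_m=\alpha(\alpha+1)\cdots(\alpha+m-1)$. The powers $z^{-b}$ and $z^{1-b}=z\,z^{-b}$ are taken on the same branch throughout. Primes denote derivatives with respect to $z$. *)

theory Defs
  imports "HOL-Analysis.Analysis"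
begin

text \<open>
  Throughout, \<open>L\<close> is a branch of the logarithm near \<open>z\<close>; all powers of \<open>z\<close> with non-integral
  exponent are taken on the branch determined by \<open>L\<close>.
\<close>

definition branch_pow :: "(complex \<Rightarrow> complex) \<Rightarrow> complex \<Rightarrow> complex \<Rightarrow> complex" where
  "branch_pow L c z = exp (c * L z)"

definition hyp1F1 :: "complex \<Rightarrow> complex \<Rightarrow> complex \<Rightarrow> complex" where
  "hyp1F1 \<alpha> \<beta> z = (\<Sum>m. pochhammer \<alpha> m / pochhammer \<beta> m * (z ^ m / fact m))"

text \<open>
  The representation of Kummer's function of the second kind for \<open>b \<notin> \<int>\<close>; not meaningful for
  integral \<open>b\<close>. Since \<open>Gamma\<close> is \<open>0\<close> at its poles and \<open>x / 0 = 0\<close>, the quotients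
  \<open>1 / Gamma a\<close> and \<open>1 / Gamma (a - b + 1)\<close> have the value \<open>0\<close> at poles, as they should.
\<close>

definition kummerU :: "(complex \<Rightarrow> complex) \<Rightarrow> complex \<Rightarrow> complex \<Rightarrow> complex \<Rightarrow> complex" where
  "kummerU L a b z =
     Gamma (1 - b) / Gamma (a - b + 1) * hyp1F1 a b z +
     branch_pow L (1 - b) z * Gamma (b - 1) / Gamma a * hyp1F1 (a - b + 1) (2 - b) z"

definition kA :: "complex \<Rightarrow> complex \<Rightarrow> nat \<Rightarrow> complex" where
  "kA a b m = Gamma (of_nat m + 1) * Gamma (2 - b + of_nat m) * Gamma (a + of_nat m + 1)"

definition kB :: "(complex \<Rightarrow> complex) \<Rightarrow> complex \<Rightarrow> complex \<Rightarrow> complex \<Rightarrow> nat \<Rightarrow> complex" where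
  "kB L a b z m =
     branch_pow L (- b) z * Gamma (a - b + 1 + of_nat m) * Gamma (b + 1 + of_nat m) *
     Gamma (of_nat m + 2)"

definition ku :: "(complex \<Rightarrow> complex) \<Rightarrow> complex \<Rightarrow> complex \<Rightarrow> complex \<Rightarrow> nat \<Rightarrow> complex" where
  "ku L a b z m = (kA a b m - kB L a b z m) / b"

definition kv :: "complex \<Rightarrow> nat \<Rightarrow> complex" where
  "kv b m = Gamma (of_nat m + 2) * Gamma (b + of_nat m + 1) * Gamma (2 - b + of_nat m)"

definition kw :: "(complex \<Rightarrow> complex) \<Rightarrow> complex \<Rightarrow> complex \<Rightarrow> complex \<Rightarrow> nat \<Rightarrow> complex" where
  "kw L a b z m = ku L a b z m / kv b m"

definition coeff_c :: "complex \<Rightarrow> nat \<Rightarrow> complex" where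
  "coeff_c a m = (of_nat m + 1) * (of_nat m + 2) * (of_nat m + a + 1)"

definition coeff_a :: "complex \<Rightarrow> complex \<Rightarrow> nat \<Rightarrow> complex" where
  "coeff_a a b m = coeff_c a m - ((of_nat m)\<^sup>2 + (a + 2) * of_nat m + a + 1) * b"

definition coeff_b :: "complex \<Rightarrow> complex \<Rightarrow> nat \<Rightarrow> complex" where
  "coeff_b a b m = coeff_c a m + (of_nat m + 2) * (a - b) * b"

definition coeff_d :: "complex \<Rightarrow> complex \<Rightarrow> nat \<Rightarrow> complex" where
  "coeff_d a b m = (coeff_a a b m - coeff_b a b m) / b"

definition ku' :: "(complex \<Rightarrow> complex) \<Rightarrow> complex \<Rightarrow> complex \<Rightarrow> complex \<Rightarrow> nat \<Rightarrow> complex" where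
  "ku' L a b z m = deriv (\<lambda>\<zeta>. ku L a b \<zeta> m) z"

definition kw' :: "(complex \<Rightarrow> complex) \<Rightarrow> complex \<Rightarrow> complex \<Rightarrow> complex \<Rightarrow> nat \<Rightarrow> complex" where
  "kw' L a b z m = deriv (\<lambda>\<zeta>. kw L a b \<zeta> m) z"

definition kwd :: "(complex \<Rightarrow> complex) \<Rightarrow> complex \<Rightarrow> complex \<Rightarrow> complex \<Rightarrow> nat \<Rightarrow> complex" where
  "kwd L a b z m = (of_nat m + 1) * kw L a b z m + z * kw' L a b z m"

end

theory Submission
  imports Defs
begin

text \<open>
  The single series for \<open>U\<close> arises by pairing terms of the two confluent hypergeometric series
  that define it. Because \<open>z\<^sup>1\<^sup>-\<^sup>b = z z\<^sup>-\<^sup>b\<close>, the second series starts at order \<open>z z\<^sup>-\<^sup>b\<close>. So the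
  constant term of the first one is split off, and its term of index \<open>m + 1\<close> is paired with the
  term of index \<open>m\<close> of the second. By the reflection formula \<open>\<Gamma>(1 - b) \<Gamma>(b)\<close> and
  \<open>\<Gamma>(b - 1) \<Gamma>(2 - b)\<close> are both \<open>\<pi> / sin (\<pi> b)\<close> up to sign, so the two series share one constant
  in front; what remains of the pair is \<open>(A\<^sub>m - B\<^sub>m) / (b v\<^sub>m)\<close>, the opposite sign accounting for
  the difference. The lemmas \<open>hyp1F1_split_first\<close>, \<open>kw_decompose\<close> and \<open>kummer_constants\<close> carry
  out this matching; since \<open>1 / \<Gamma>(a)\<close> may be zero, convergence is obtained from the ratio test for
  the two parts of \<open>w\<^sub>m\<close> and not from convergence of the series for \<open>U\<close>.

  In this form \<open>U\<close> is a constant plus a combination of \<open>z F(z)\<close> and \<open>z\<^sup>-\<^sup>b z G(z)\<close> with entire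
  \<open>F\<close> and \<open>G\<close>. Differentiating \<open>z F(z)\<close> and \<open>z G(z)\<close> term by term gives the factors \<open>m + 1\<close> of
  \<open>w\<^sub>m\<^sup>d\<close>, and differentiating \<open>z\<^sup>-\<^sup>b\<close> gives \<open>- (b / z) z\<^sup>-\<^sup>b\<close>, which is where \<open>u\<^sub>m' = B\<^sub>m / z\<close>
  comes from. The recurrences are the functional equation of \<open>\<Gamma>\<close>, and the limit \<open>b \<rightarrow> 0\<close> of \<open>u\<^sub>m\<close>
  is a derivative.
\<close>

section \<open>Everywhere convergent hypergeometric series\<close>

definition hyp1F1_coeff :: "complex \<Rightarrow> complex \<Rightarrow> nat \<Rightarrow> complex" where
  "hyp1F1_coeff \<alpha> \<beta> m = pochhammer \<alpha> m / pochhammer \<beta> m / fact m"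

lemma add_of_nat_notin_nonpos_Ints:
  fixes x :: "'a :: ring_char_0"
  assumes "x \<notin> \<int>\<^sub>\<le>\<^sub>0"
  shows "x + of_nat n \<notin> \<int>\<^sub>\<le>\<^sub>0"
  using nonpos_Ints_diff_Nats[of "x + of_nat n" "of_nat n"] assms by auto

text \<open>
  This holds for all \<open>\<beta>\<close>: if \<open>\<beta>\<close> is a non-positive integer, the coefficients vanish from
  some index on, as division by zero gives zero. The ratio of consecutive terms is written with
  \<open>(\<alpha> + m) / (\<beta> + m) = 1 + (\<alpha> - \<beta>) / (\<beta> + m)\<close>, which shows that it tends to zero.
\<close>
lemma summable_hyp1F1_coeff:
  "summable (\<lambda>m. norm (hyp1F1_coeff \<alpha> \<beta> m * y ^ m))"
proof -
  let ?r = "\<lambda>m. (1 + (\<alpha> - \<beta>) * inverse (\<beta> + of_nat m)) * (inverse (of_nat (Suc m)) * y)"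
  have "filterlim (\<lambda>m. \<beta> + of_nat m) at_infinity sequentially"
    by (intro tendsto_add_filterlim_at_infinity[OF tendsto_const] tendsto_of_nat)
  hence "(\<lambda>m. inverse (\<beta> + of_nat m)) \<longlonglongrightarrow> 0"
    by (rule filterlim_compose[OF tendsto_inverse_0])
  moreover have "(\<lambda>m. inverse (of_nat (Suc m)) :: complex) \<longlonglongrightarrow> 0"
    by (rule LIMSEQ_Suc[OF lim_inverse_n])
  ultimately have "?r \<longlonglongrightarrow> (1 + (\<alpha> - \<beta>) * 0) * (0 * y)"
    by (intro tendsto_intros)
  hence "\<forall>\<^sub>F m in sequentially. dist (?r m) 0 < 1 / 2"
    by (intro tendstoD) auto
  moreover have "\<forall>\<^sub>F m in sequentially. \<beta> + of_nat m \<noteq> 0"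
    using \<open>filterlim (\<lambda>m. \<beta> + of_nat m) at_infinity sequentially\<close>
    by (rule filterlim_at_infinity_imp_eventually_ne)
  ultimately have "\<forall>\<^sub>F m in sequentially. norm (?r m) < 1 / 2 \<and> \<beta> + of_nat m \<noteq> 0"
    by eventually_elim simp
  then obtain N where N: "\<And>m. m \<ge> N \<Longrightarrow> norm (?r m) < 1 / 2 \<and> \<beta> + of_nat m \<noteq> 0"
    by (auto simp: eventually_at_top_linorder)
  show ?thesis
  proof (rule summable_ratio_test)
    show "1 / 2 < (1 :: real)" by simp
    fix m assume "N \<le> m"
    with N have m: "norm (?r m) < 1 / 2" "\<beta> + of_nat m \<noteq> 0" by auto
    have "hyp1F1_coeff \<alpha> \<beta> (Suc m) * y ^ Suc m
        = ((\<alpha> + of_nat m) * inverse (\<beta> + of_nat m)) * (inverse (of_nat (Suc m)) * y) *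
          (hyp1F1_coeff \<alpha> \<beta> m * y ^ m)"
      unfolding hyp1F1_coeff_def pochhammer_rec' fact_Suc power_Suc
      by (simp add: divide_inverse mult_ac)
    also have "(\<alpha> + of_nat m) * inverse (\<beta> + of_nat m)
        = 1 + (\<alpha> - \<beta>) * inverse (\<beta> + of_nat m)"
      using m(2) by (simp add: field_simps)
    finally have "norm (hyp1F1_coeff \<alpha> \<beta> (Suc m) * y ^ Suc m)
        = norm (?r m) * norm (hyp1F1_coeff \<alpha> \<beta> m * y ^ m)"
      by (simp only: norm_mult)
    also have "\<dots> \<le> 1 / 2 * norm (hyp1F1_coeff \<alpha> \<beta> m * y ^ m)"
      using m(1) by (intro mult_right_mono) auto
    finally show "norm (norm (hyp1F1_coeff \<alpha> \<beta> (Suc m) * y ^ Suc m))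
        \<le> 1 / 2 * norm (norm (hyp1F1_coeff \<alpha> \<beta> m * y ^ m))" by simp
  qed
qed

lemma summable_hyp1F1_coeff_div:
  "summable (\<lambda>m. hyp1F1_coeff \<alpha> \<beta> m / of_nat (Suc m) * y ^ m)"
proof (rule summable_comparison_test[OF _ summable_hyp1F1_coeff])
  have "norm (hyp1F1_coeff \<alpha> \<beta> m / of_nat (Suc m) * y ^ m)
      \<le> norm (hyp1F1_coeff \<alpha> \<beta> m * y ^ m)" for m
  proof -
    have "norm (hyp1F1_coeff \<alpha> \<beta> m / of_nat (Suc m) * y ^ m)
        = norm (hyp1F1_coeff \<alpha> \<beta> m * y ^ m) / real (Suc m)"
      by (simp only: norm_mult norm_divide norm_of_nat times_divide_eq_left)
    also have "\<dots> \<le> norm (hyp1F1_coeff \<alpha> \<beta> m * y ^ m)"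
      by (simp only: divide_le_eq_1 divide_le_eq) (simp add: mult_le_cancel_left1)
    finally show ?thesis .
  qed
  thus "\<exists>N. \<forall>m\<ge>N. norm (hyp1F1_coeff \<alpha> \<beta> m / of_nat (Suc m) * y ^ m)
      \<le> norm (hyp1F1_coeff \<alpha> \<beta> m * y ^ m)" by blast
qed

text \<open>
  Taking the factor \<open>\<alpha> / \<beta>\<close> out leaves coefficients that do not vanish for \<open>\<alpha> = 0\<close>; they are the
  ones that occur in \<open>w\<^sub>m\<close>.
\<close>
lemma hyp1F1_split_first:
  "hyp1F1 \<alpha> \<beta> y =
     1 + \<alpha> / \<beta> * (y * (\<Sum>m. hyp1F1_coeff (\<alpha> + 1) (\<beta> + 1) m / of_nat (Suc m) * y ^ m))"
proof -
  have trm: "pochhammer \<alpha> n / pochhammer \<beta> n * (y ^ n / fact n) = hyp1F1_coeff \<alpha> \<beta> n * y ^ n" for n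
    by (simp add: hyp1F1_coeff_def)
  have "summable (\<lambda>n. hyp1F1_coeff \<alpha> \<beta> n * y ^ n)"
    by (rule summable_norm_cancel[OF summable_hyp1F1_coeff])
  hence "hyp1F1 \<alpha> \<beta> y = 1 + (\<Sum>m. hyp1F1_coeff \<alpha> \<beta> (Suc m) * y ^ Suc m)"
    unfolding hyp1F1_def trm by (subst suminf_split_head) (simp_all add: hyp1F1_coeff_def)
  also have "(\<lambda>m. hyp1F1_coeff \<alpha> \<beta> (Suc m) * y ^ Suc m)
      = (\<lambda>m. (\<alpha> / \<beta> * y) * (hyp1F1_coeff (\<alpha> + 1) (\<beta> + 1) m / of_nat (Suc m) * y ^ m))"
    unfolding hyp1F1_coeff_def pochhammer_rec fact_Suc power_Suc
    by (simp add: divide_inverse mult_ac)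
  also have "(\<Sum>m. (\<alpha> / \<beta> * y) * (hyp1F1_coeff (\<alpha> + 1) (\<beta> + 1) m / of_nat (Suc m) * y ^ m))
      = \<alpha> / \<beta> * y * (\<Sum>m. hyp1F1_coeff (\<alpha> + 1) (\<beta> + 1) m / of_nat (Suc m) * y ^ m)"
    by (rule suminf_mult[OF summable_hyp1F1_coeff_div])
  finally show ?thesis by (simp add: mult.assoc)
qed

text \<open>
  Read \<open>\<zeta> \<Sum> c\<^sub>m \<zeta>\<^sup>m\<close> as the power series with coefficients \<open>0, c\<^sub>0, c\<^sub>1, \<dots>\<close>: differentiating
  term by term then restores the exponent \<open>m\<close> and produces the factor \<open>m + 1\<close> of \<open>w\<^sub>m\<^sup>d\<close>.
\<close>
lemma mult_power_series_derivative:
  fixes c :: "nat \<Rightarrow> complex"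
  assumes c: "\<And>y. summable (\<lambda>m. c m * y ^ m)"
  shows "summable (\<lambda>m. of_nat (Suc m) * c m * z ^ m)"
    and "((\<lambda>\<zeta>. \<zeta> * (\<Sum>m. c m * \<zeta> ^ m)) has_field_derivative
           (\<Sum>m. of_nat (Suc m) * c m * z ^ m)) (at z)"
proof -
  define e where "e = case_nat 0 c"
  have e: "e 0 = 0" "\<And>m. e (Suc m) = c m" by (simp_all add: e_def)
  have diffs: "diffs e m = of_nat (Suc m) * c m" for m by (simp add: diffs_def e)
  have shift: "(\<lambda>m. e (Suc m) * y ^ Suc m) = (\<lambda>m. y * (c m * y ^ m))" for y
    by (simp add: e mult_ac)
  have sum_e: "summable (\<lambda>n. e n * y ^ n)" for y
    by (subst summable_Suc_iff[symmetric], unfold shift, rule summable_mult[OF c])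
  show "summable (\<lambda>m. of_nat (Suc m) * c m * z ^ m)"
    using termdiff_converges_all[OF sum_e, of z] by (simp only: diffs)
  have "(\<lambda>\<zeta>. \<Sum>n. e n * \<zeta> ^ n) = (\<lambda>\<zeta>. \<zeta> * (\<Sum>m. c m * \<zeta> ^ m))"
  proof
    fix \<zeta>
    show "(\<Sum>n. e n * \<zeta> ^ n) = \<zeta> * (\<Sum>m. c m * \<zeta> ^ m)"
      using suminf_split_head[OF sum_e, of \<zeta>] suminf_mult[OF c, of \<zeta> \<zeta>]
      unfolding shift by (simp add: e)
  qed
  with termdiffs_strong_converges_everywhere[OF sum_e, of z]
  show "((\<lambda>\<zeta>. \<zeta> * (\<Sum>m. c m * \<zeta> ^ m)) has_field_derivative
           (\<Sum>m. of_nat (Suc m) * c m * z ^ m)) (at z)"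
    by (simp only: diffs)
qed

section \<open>Branches of the logarithm\<close>

text \<open>
  Continuity suffices for a right inverse of \<open>exp\<close> on an open set to be differentiable, since the
  derivative of \<open>exp\<close> has no zeros.
\<close>
lemma log_branch_has_field_derivative:
  assumes "open S" "z \<in> S" "continuous_on S L" "\<And>\<zeta>. \<zeta> \<in> S \<Longrightarrow> exp (L \<zeta>) = \<zeta>"
  shows "(L has_field_derivative inverse z) (at z)"
proof (rule has_field_derivative_inverse_basic[where f = exp and t = S])
  show "(exp has_field_derivative z) (at (L z))"
    using DERIV_exp[of "L z"] assms(2,4) by simp
  show "z \<noteq> 0" using assms(4)[OF assms(2)] exp_not_eq_zero by metis
  show "continuous (at z) L" using assms by (simp add: continuous_on_eq_continuous_at)
qed (use assms in auto)

lemma branch_pow_has_field_derivative: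
  assumes "(L has_field_derivative inverse z) (at z)"
  shows "(branch_pow L c has_field_derivative c / z * branch_pow L c z) (at z)"
  unfolding branch_pow_def [abs_def]
  by (rule derivative_eq_intros refl assms)+ (simp add: field_simps)

lemma branch_pow_one_minus:
  assumes "exp (L z) = z"
  shows "branch_pow L (1 - b) z = z * branch_pow L (- b) z"
proof -
  have "branch_pow L (1 - b) z = exp (L z) * exp (- b * L z)"
    unfolding branch_pow_def exp_add[symmetric] by (simp add: algebra_simps)
  with assms show ?thesis by (simp add: branch_pow_def)
qed

section \<open>The coefficients \<open>u\<^sub>m\<close> and \<open>w\<^sub>m\<close>\<close>

lemma Gamma_add_of_nat:
  fixes x :: complex
  assumes "x \<notin> \<int>\<^sub>\<le>\<^sub>0"
  shows "Gamma (x + of_nat m) = pochhammer x m * Gamma x"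
  using assms by (simp add: pochhammer_Gamma Gamma_eq_zero_iff)

text \<open>
  Dividing \<open>A\<^sub>m\<close> and \<open>B\<^sub>m\<close> by \<open>v\<^sub>m m!\<close> leaves one quotient of Gamma functions each: up to a
  constant factor, a coefficient of a confluent hypergeometric series.
\<close>
lemma kA_div_kv:
  assumes b: "b \<notin> \<int>" and a1: "a + 1 \<notin> \<int>\<^sub>\<le>\<^sub>0"
  shows "kA a b m / kv b m / fact m =
     b * (Gamma (a + 1) / (b * Gamma (b + 1)) * (hyp1F1_coeff (a + 1) (b + 1) m / of_nat (Suc m)))"
proof -
  have nz: "b \<noteq> 0" "b + 1 \<notin> \<int>\<^sub>\<le>\<^sub>0" "2 - b + of_nat m \<notin> \<int>\<^sub>\<le>\<^sub>0"
    using b Ints_diff[of "b + 1" 1] Ints_diff[of 2 "2 - b"]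
      add_of_nat_notin_nonpos_Ints[of "2 - b" m] by (auto dest!: nonpos_Ints_Int)
  have s: "a + of_nat m + 1 = a + 1 + of_nat m" "b + of_nat m + 1 = b + 1 + of_nat m"
    "of_nat m + 1 = (1 + of_nat m :: complex)" "of_nat m + 2 = (1 + of_nat (Suc m) :: complex)"
    by simp_all
  show ?thesis
    unfolding kA_def kv_def s Gamma_fact Gamma_add_of_nat[OF a1] Gamma_add_of_nat[OF nz(2)]
      hyp1F1_coeff_def fact_Suc
    using nz by (simp add: Gamma_eq_zero_iff divide_inverse mult_ac)
qed

lemma kB_div_kv:
  assumes b: "b \<notin> \<int>" and ab: "a - b + 1 \<notin> \<int>\<^sub>\<le>\<^sub>0"
  shows "kB L a b z m / kv b m / fact m =
     b * (Gamma (a - b + 1) / (b * Gamma (2 - b)) * branch_pow L (- b) z *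
       hyp1F1_coeff (a - b + 1) (2 - b) m)"
proof -
  have nz: "b \<noteq> 0" "2 - b \<notin> \<int>\<^sub>\<le>\<^sub>0" "b + 1 + of_nat m \<notin> \<int>\<^sub>\<le>\<^sub>0"
      "of_nat m + 2 \<notin> (\<int>\<^sub>\<le>\<^sub>0 :: complex set)"
    using b Ints_diff[of "b + 1" 1] Ints_diff[of 2 "2 - b"]
      add_of_nat_notin_nonpos_Ints[of "b + 1" m] add_of_nat_notin_nonpos_Ints[of "2 :: complex" m]
    by (auto simp: add_ac dest!: nonpos_Ints_Int)
  have s: "b + of_nat m + 1 = b + 1 + of_nat m" by simp
  show ?thesis
    unfolding kB_def kv_def s Gamma_add_of_nat[OF ab] Gamma_add_of_nat[OF nz(2)] hyp1F1_coeff_def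
    using nz by (simp add: Gamma_eq_zero_iff divide_inverse mult_ac)
qed

lemma kw_decompose:
  assumes "b \<notin> \<int>" and "a + 1 \<notin> \<int>\<^sub>\<le>\<^sub>0" and "a - b + 1 \<notin> \<int>\<^sub>\<le>\<^sub>0"
  shows "kw L a b z m / fact m =
     Gamma (a + 1) / (b * Gamma (b + 1)) * (hyp1F1_coeff (a + 1) (b + 1) m / of_nat (Suc m)) -
     Gamma (a - b + 1) / (b * Gamma (2 - b)) * branch_pow L (- b) z *
       hyp1F1_coeff (a - b + 1) (2 - b) m"
proof -
  have "b \<noteq> 0" using assms(1) by auto
  have "kw L a b z m / fact m
      = (kA a b m / kv b m / fact m - kB L a b z m / kv b m / fact m) / b"
    unfolding kw_def ku_def by (simp add: diff_divide_distrib mult_ac)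
  also have "\<dots> =
     Gamma (a + 1) / (b * Gamma (b + 1)) * (hyp1F1_coeff (a + 1) (b + 1) m / of_nat (Suc m)) -
     Gamma (a - b + 1) / (b * Gamma (2 - b)) * branch_pow L (- b) z *
       hyp1F1_coeff (a - b + 1) (2 - b) m"
    unfolding kA_div_kv[OF assms(1,2)] kB_div_kv[OF assms(1,3)] right_diff_distrib[symmetric]
    using \<open>b \<noteq> 0\<close> by (rule nonzero_mult_div_cancel_left)
  finally show ?thesis .
qed

lemma kA_Suc:
  assumes "b \<notin> \<int>" "a + 1 \<notin> \<int>\<^sub>\<le>\<^sub>0"
  shows "kA a b (Suc m) = coeff_a a b m * kA a b m"
proof -
  have nz: "of_nat m + 1 \<notin> (\<int>\<^sub>\<le>\<^sub>0 :: complex set)" "2 - b + of_nat m \<notin> \<int>\<^sub>\<le>\<^sub>0"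
      "a + of_nat m + 1 \<notin> \<int>\<^sub>\<le>\<^sub>0"
    using add_of_nat_notin_nonpos_Ints[of "1::complex" m]
      add_of_nat_notin_nonpos_Ints[of "2 - b" m] add_of_nat_notin_nonpos_Ints[OF assms(2), of m]
      assms(1) Ints_diff[of 2 "2 - b"]
    by (auto simp: add_ac dest!: nonpos_Ints_Int)
  have s: "of_nat (Suc m) + 1 = (of_nat m + 1) + (1::complex)"
    "2 - b + of_nat (Suc m) = (2 - b + of_nat m) + 1"
    "a + of_nat (Suc m) + 1 = (a + of_nat m + 1) + 1" by simp_all
  show ?thesis
    unfolding kA_def s Gamma_plus1[OF nz(1)] Gamma_plus1[OF nz(2)] Gamma_plus1[OF nz(3)]
      coeff_a_def coeff_c_def power2_eq_square
    by (simp add: algebra_simps)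
qed

lemma kB_Suc:
  assumes "b \<notin> \<int>" "a - b + 1 \<notin> \<int>\<^sub>\<le>\<^sub>0"
  shows "kB L a b z (Suc m) = coeff_b a b m * kB L a b z m"
proof -
  have nz: "of_nat m + 2 \<notin> (\<int>\<^sub>\<le>\<^sub>0 :: complex set)" "b + 1 + of_nat m \<notin> \<int>\<^sub>\<le>\<^sub>0"
      "a - b + 1 + of_nat m \<notin> \<int>\<^sub>\<le>\<^sub>0"
    using add_of_nat_notin_nonpos_Ints[of "2::complex" m]
      add_of_nat_notin_nonpos_Ints[of "b + 1" m] add_of_nat_notin_nonpos_Ints[OF assms(2), of m]
      assms(1) Ints_diff[of "b + 1" 1]
    by (auto simp: add_ac dest!: nonpos_Ints_Int)
  have s: "of_nat (Suc m) + 2 = (of_nat m + 2) + (1::complex)"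
    "b + 1 + of_nat (Suc m) = (b + 1 + of_nat m) + 1"
    "a - b + 1 + of_nat (Suc m) = (a - b + 1 + of_nat m) + 1" by simp_all
  show ?thesis
    unfolding kB_def s Gamma_plus1[OF nz(1)] Gamma_plus1[OF nz(2)] Gamma_plus1[OF nz(3)]
      coeff_b_def coeff_c_def
    by (simp add: algebra_simps)
qed

lemma coeff_d_eq:
  assumes "b \<noteq> 0"
  shows "coeff_d a b m =
    - ((of_nat m)\<^sup>2 + 2 * of_nat m * (a + 1) + 3 * a + 1) + (of_nat m + 2) * b"
  using assms unfolding coeff_d_def coeff_a_def coeff_b_def power2_eq_square
  by (simp add: field_simps)

text \<open>
  At \<open>\<beta> = 0\<close> both \<open>A\<^sub>m\<close> and \<open>B\<^sub>m\<close> equal \<open>m! (m + 1)! \<Gamma>(a + m + 1)\<close>. As they are analytic in \<open>\<beta>\<close>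
  there, \<open>u\<^sub>m\<close> is a difference quotient of \<open>A\<^sub>m - B\<^sub>m\<close> and converges to its derivative.
\<close>
lemma ku_limit:
  assumes "a + 1 \<notin> \<int>\<^sub>\<le>\<^sub>0"
  shows "\<exists>l. ((\<lambda>\<beta>. ku L a \<beta> z m) \<longlongrightarrow> l) (at 0)"
proof -
  define f where "f \<beta> = kA a \<beta> m - kB L a \<beta> z m" for \<beta>
  have a: "a + 1 + of_nat m \<notin> \<int>\<^sub>\<le>\<^sub>0" "1 + of_nat m \<notin> (\<int>\<^sub>\<le>\<^sub>0 :: complex set)"
    "2 + of_nat m \<notin> (\<int>\<^sub>\<le>\<^sub>0 :: complex set)"
    using assms by (simp_all add: add_of_nat_notin_nonpos_Ints)
  have "f analytic_on {0}"
    unfolding f_def kA_def kB_def branch_pow_def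
    using a by (intro analytic_intros) auto
  hence "f field_differentiable (at 0)"
    by (rule analytic_on_imp_differentiable_at) simp
  then obtain D where "(f has_field_derivative D) (at 0)"
    unfolding field_differentiable_def by blast
  moreover have "f 0 = 0"
    unfolding f_def kA_def kB_def branch_pow_def by (simp add: add_ac)
  ultimately have "((\<lambda>\<beta>. f \<beta> / \<beta>) \<longlongrightarrow> D) (at 0)"
    by (simp add: has_field_derivative_iff)
  thus ?thesis unfolding ku_def f_def by blast
qed

lemma ku_has_field_derivative:
  assumes "b \<noteq> 0" and L: "(L has_field_derivative inverse z) (at z)"
  shows "((\<lambda>\<zeta>. ku L a b \<zeta> m) has_field_derivative 1 / z * kB L a b z m) (at z)"
  unfolding ku_def kB_def
  by (rule derivative_eq_intros branch_pow_has_field_derivative[OF L] refl)+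
     (use assms(1) in simp_all)

section \<open>Kummer's function as a single series\<close>

lemma Gamma_reflection_shifts:
  fixes b :: complex
  assumes "b \<notin> \<int>"
  shows "Gamma (1 - b) * Gamma (b + 1) = of_real pi * b / sin (of_real pi * b)"
    and "Gamma (b - 1) * Gamma (2 - b) = - of_real pi / sin (of_real pi * b)"
    and "Gamma (b + 1) * Gamma (2 - b) = (1 - b) * of_real pi * b / sin (of_real pi * b)"
proof -
  have nz: "b \<notin> \<int>\<^sub>\<le>\<^sub>0" "1 - b \<notin> \<int>\<^sub>\<le>\<^sub>0"
    using assms Ints_diff[of 1 "1 - b"] by (auto dest!: nonpos_Ints_Int)
  note refl = Gamma_reflection_complex[of b]
  have b1: "Gamma (b + 1) = b * Gamma b" by (rule Gamma_plus1[OF nz(1)])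
  have b2: "Gamma (2 - b) = (1 - b) * Gamma (1 - b)"
    using Gamma_plus1[OF nz(2)] by simp
  show "Gamma (1 - b) * Gamma (b + 1) = of_real pi * b / sin (of_real pi * b)"
    using refl by (simp add: b1 mult_ac)
  show "Gamma (b + 1) * Gamma (2 - b) = (1 - b) * of_real pi * b / sin (of_real pi * b)"
    using refl by (simp add: b1 b2 mult_ac)
  have "sin (of_real pi * (b - 1)) = - sin (of_real pi * b)"
    by (simp add: ring_distribs sin_diff)
  thus "Gamma (b - 1) * Gamma (2 - b) = - of_real pi / sin (of_real pi * b)"
    using Gamma_reflection_complex[of "b - 1"] by simp
qed

text \<open>
  The case \<open>a = 0\<close> is the only one in which \<open>1 / \<Gamma>(a)\<close> vanishes; both sides are then zero.
\<close>
lemma kummer_constants: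
  fixes a b :: complex
  assumes b: "b \<notin> \<int>" and a1: "a + 1 \<notin> \<int>\<^sub>\<le>\<^sub>0" and ab: "a - b + 1 \<notin> \<int>\<^sub>\<le>\<^sub>0"
  defines "K \<equiv> of_real pi * b / (sin (of_real pi * b) * Gamma a * Gamma (a - b + 1))"
  shows "K * (Gamma (a + 1) / (b * Gamma (b + 1))) = Gamma (1 - b) / Gamma (a - b + 1) * (a / b)"
    and "K * (Gamma (a - b + 1) / (b * Gamma (2 - b))) = - (Gamma (b - 1) / Gamma a)"
proof -
  have nz: "b \<noteq> 0" "Gamma (a - b + 1) \<noteq> 0" "Gamma (b + 1) \<noteq> 0" "Gamma (2 - b) \<noteq> 0"
    using b ab Ints_diff[of "b + 1" 1] Ints_diff[of 2 "2 - b"]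
    by (auto simp: Gamma_eq_zero_iff dest!: nonpos_Ints_Int)
  note r = Gamma_reflection_shifts[OF b]
  have K: "K = (Gamma (1 - b) * Gamma (b + 1)) / (Gamma a * Gamma (a - b + 1))"
    unfolding K_def r by (simp add: mult_ac)
  have K': "K = - b * (Gamma (b - 1) * Gamma (2 - b)) / (Gamma a * Gamma (a - b + 1))"
    unfolding K_def r by (simp add: mult_ac)
  show "K * (Gamma (a + 1) / (b * Gamma (b + 1))) = Gamma (1 - b) / Gamma (a - b + 1) * (a / b)"
  proof (cases "a = 0")
    case False
    have "a \<notin> \<int>\<^sub>\<le>\<^sub>0"
    proof
      assume "a \<in> \<int>\<^sub>\<le>\<^sub>0"
      then obtain n where n: "a = - of_nat n" by (rule nonpos_Ints_cases')
      with \<open>a \<noteq> 0\<close> obtain k where "n = Suc k" by (cases n) auto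
      with n have "a + 1 = - of_nat k" by simp
      with a1 show False by simp
    qed
    hence "Gamma a \<noteq> 0" "Gamma (a + 1) = a * Gamma a"
      by (simp_all add: Gamma_eq_zero_iff Gamma_plus1)
    thus ?thesis unfolding K using nz by (simp add: field_simps)
  qed (simp add: K)
  show "K * (Gamma (a - b + 1) / (b * Gamma (2 - b))) = - (Gamma (b - 1) / Gamma a)"
    unfolding K' using nz by (simp add: field_simps)
qed


theorem mainTheorem1:
  fixes a b z :: complex and S :: "complex set" and L :: "complex \<Rightarrow> complex"
  assumes "z \<noteq> 0" and "b \<notin> \<int>"
    and "open S" and "z \<in> S" and "continuous_on S L" and "\<And>\<zeta>. \<zeta> \<in> S \<Longrightarrow> exp (L \<zeta>) = \<zeta>"
    and "a + 1 \<notin> \<int>\<^sub>\<le>\<^sub>0" and "a - b + 1 \<notin> \<int>\<^sub>\<le>\<^sub>0"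
  shows
    "(summable (\<lambda>m. kw L a b z m * (z ^ m / fact m)) \<and>
      kummerU L a b z =
        Gamma (1 - b) / Gamma (a - b + 1) +
        of_real pi * b * z / (sin (of_real pi * b) * Gamma a * Gamma (a - b + 1)) *
          (\<Sum>m. kw L a b z m * (z ^ m / fact m)) \<and>
      (\<forall>m. \<exists>l. ((\<lambda>\<beta>. ku L a \<beta> z m) \<longlongrightarrow> l) (at 0)))
     \<and>
     ((\<forall>m. ku L a b z (Suc m) = (coeff_a a b m * kA a b m - coeff_b a b m * kB L a b z m) / b \<and>
           ku L a b z (Suc m) = coeff_a a b m * ku L a b z m + coeff_d a b m * kB L a b z m \<and>
           coeff_d a b m =
             - ((of_nat m)\<^sup>2 + 2 * of_nat m * (a + 1) + 3 * a + 1) + (of_nat m + 2) * b) \<and>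
      kv b 0 = Gamma (b + 1) * Gamma (2 - b) \<and>
      Gamma (b + 1) * Gamma (2 - b) = (1 - b) * of_real pi * b / sin (of_real pi * b))
     \<and>
     (summable (\<lambda>m. kwd L a b z m * (z ^ m / fact m)) \<and>
      ((\<lambda>\<zeta>. kummerU L a b \<zeta>) has_field_derivative
         of_real pi * b / (sin (of_real pi * b) * Gamma a * Gamma (a - b + 1)) *
           (\<Sum>m. kwd L a b z m * (z ^ m / fact m))) (at z) \<and>
      (\<forall>m. (\<lambda>\<zeta>. ku L a b \<zeta> m) field_differentiable (at z) \<and>
           (\<lambda>\<zeta>. kw L a b \<zeta> m) field_differentiable (at z) \<and>
           kw' L a b z m = ku' L a b z m / kv b m \<and>
           ku' L a b z m = 1 / z * kB L a b z m))"
proof -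
  \<comment> \<open>Below, \<open>\<Sum> w\<^sub>m z\<^sup>m / m!\<close> becomes \<open>P F(z) - Q z\<^sup>-\<^sup>b G(z)\<close> with \<open>F\<close> and \<open>G\<close> entire.\<close>
  define K where "K = of_real pi * b / (sin (of_real pi * b) * Gamma a * Gamma (a - b + 1))"
  define C where "C = Gamma (1 - b) / Gamma (a - b + 1)"
  define P where "P = Gamma (a + 1) / (b * Gamma (b + 1))"
  define Q where "Q = Gamma (a - b + 1) / (b * Gamma (2 - b))"
  define p where "p m = hyp1F1_coeff (a + 1) (b + 1) m / of_nat (Suc m)" for m
  define q where "q = hyp1F1_coeff (a - b + 1) (2 - b)"
  define F where "F \<zeta> = (\<Sum>m. p m * \<zeta> ^ m)" for \<zeta>
  define G where "G \<zeta> = (\<Sum>m. q m * \<zeta> ^ m)" for \<zeta>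
  define F' where "F' = (\<Sum>m. of_nat (Suc m) * p m * z ^ m)"
  define G' where "G' = (\<Sum>m. of_nat (Suc m) * q m * z ^ m)"
  define E where "E = branch_pow L (- b)"
  have b0: "b \<noteq> 0" using \<open>b \<notin> \<int>\<close> by auto
  have sum_p: "summable (\<lambda>m. p m * y ^ m)" for y
    unfolding p_def by (rule summable_hyp1F1_coeff_div)
  have sum_q: "summable (\<lambda>m. q m * y ^ m)" for y
    unfolding q_def by (rule summable_norm_cancel[OF summable_hyp1F1_coeff])
  note F = mult_power_series_derivative[of p z, OF sum_p, folded F_def F'_def]
  note G = mult_power_series_derivative[of q z, OF sum_q, folded G_def G'_def]
  note K = kummer_constants[OF assms(2,7,8), folded K_def C_def P_def Q_def]
  note rec = kA_Suc[OF assms(2,7)] kB_Suc[OF assms(2,8)]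
  have L: "(L has_field_derivative inverse z) (at z)"
    using log_branch_has_field_derivative assms by blast

  have U: "kummerU L a b \<zeta> = C + K * (P * (\<zeta> * F \<zeta>) - Q * (E \<zeta> * (\<zeta> * G \<zeta>)))" if "\<zeta> \<in> S" for \<zeta>
  proof -
    have "kummerU L a b \<zeta> =
        C * (1 + a / b * (\<zeta> * F \<zeta>)) + \<zeta> * E \<zeta> * (Gamma (b - 1) / Gamma a) * G \<zeta>"
      unfolding kummerU_def branch_pow_one_minus[of L, OF assms(6)[OF that]]
      by (simp add: hyp1F1_split_first[of a b] hyp1F1_def[of "a - b + 1"] C_def F_def G_def E_def
          p_def q_def hyp1F1_coeff_def)
    also have "\<dots> = C + (C * (a / b)) * (\<zeta> * F \<zeta>) - (- (Gamma (b - 1) / Gamma a)) * (E \<zeta> * (\<zeta> * G \<zeta>))"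
      by (simp add: algebra_simps)
    finally show ?thesis unfolding K[symmetric] by (simp add: algebra_simps)
  qed

  have kw: "kw L a b z m * (z ^ m / fact m) = P * (p m * z ^ m) - Q * E z * (q m * z ^ m)" for m
  proof -
    have "kw L a b z m * (z ^ m / fact m) = kw L a b z m / fact m * z ^ m" by simp
    also have "kw L a b z m / fact m = P * p m - Q * E z * q m"
      unfolding P_def Q_def p_def q_def E_def by (rule kw_decompose[OF assms(2,7,8)])
    finally show ?thesis by (simp add: algebra_simps)
  qed
  have w_sums: "(\<lambda>m. kw L a b z m * (z ^ m / fact m)) sums (P * F z - Q * E z * G z)"
    unfolding kw F_def G_def
    by (intro sums_diff sums_mult summable_sums sum_p sum_q)

  have ku': "((\<lambda>\<zeta>. ku L a b \<zeta> m) has_field_derivative 1 / z * kB L a b z m) (at z)" for m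
    by (rule ku_has_field_derivative[OF b0 L])
  have kw': "((\<lambda>\<zeta>. kw L a b \<zeta> m) has_field_derivative 1 / z * kB L a b z m / kv b m) (at z)" for m
    unfolding kw_def by (rule DERIV_cdivide[OF ku'])
  have eq': "ku' L a b z m = 1 / z * kB L a b z m"
      "kw' L a b z m = 1 / z * kB L a b z m / kv b m" for m
    unfolding ku'_def kw'_def by (rule DERIV_imp_deriv[OF ku'] DERIV_imp_deriv[OF kw'])+

  have kB: "kB L a b z m / kv b m / fact m = b * (Q * E z * q m)" for m
    unfolding Q_def q_def E_def by (rule kB_div_kv[OF assms(2,8)])
  have kwd: "kwd L a b z m * (z ^ m / fact m) =
      P * (of_nat (Suc m) * p m * z ^ m) -
      Q * E z * (of_nat (Suc m) * q m * z ^ m - b * (q m * z ^ m))" for m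
  proof -
    \<comment> \<open>The factor \<open>z\<close> in front of \<open>w\<^sub>m'\<close> cancels the \<open>1 / z\<close> of \<open>u\<^sub>m'\<close>.\<close>
    have "kwd L a b z m * (z ^ m / fact m) =
        of_nat (Suc m) * (kw L a b z m * (z ^ m / fact m)) + (kB L a b z m / kv b m / fact m) * z ^ m"
      unfolding kwd_def eq' using assms(1) by (simp add: algebra_simps add_divide_distrib)
    thus ?thesis unfolding kw kB by (simp add: algebra_simps)
  qed
  have wd_sums: "(\<lambda>m. kwd L a b z m * (z ^ m / fact m)) sums
      (P * F' - Q * E z * (G' - b * G z))"
    unfolding kwd F'_def G'_def G_def
    by (intro sums_diff sums_mult summable_sums F(1) G(1) sum_q)

  have "((\<lambda>\<zeta>. C + K * (P * (\<zeta> * F \<zeta>) - Q * (E \<zeta> * (\<zeta> * G \<zeta>)))) has_field_derivative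
      K * (P * F' - Q * E z * (G' - b * G z))) (at z)"
    unfolding E_def
    by (rule derivative_eq_intros F(2) G(2) branch_pow_has_field_derivative[OF L] refl)+
       (use assms(1) in \<open>simp add: field_simps\<close>)
  \<comment> \<open>The single-series form is valid on all of \<open>S\<close>, so it may be differentiated at \<open>z\<close>.\<close>
  hence U': "((\<lambda>\<zeta>. kummerU L a b \<zeta>) has_field_derivative
      K * (P * F' - Q * E z * (G' - b * G z))) (at z)"
    by (rule has_field_derivative_transform_within_open[OF _ assms(3,4)]) (simp add: U)

  have part1: "summable (\<lambda>m. kw L a b z m * (z ^ m / fact m))"
    "kummerU L a b z = C + of_real pi * b * z / (sin (of_real pi * b) * Gamma a * Gamma (a - b + 1)) *
       (\<Sum>m. kw L a b z m * (z ^ m / fact m))"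
  proof -
    show "summable (\<lambda>m. kw L a b z m * (z ^ m / fact m))"
      using w_sums by (rule sums_summable)
    have Kz: "of_real pi * b * z / (sin (of_real pi * b) * Gamma a * Gamma (a - b + 1)) = K * z"
      by (simp add: K_def)
    show "kummerU L a b z = C + of_real pi * b * z / (sin (of_real pi * b) * Gamma a * Gamma (a - b + 1)) *
       (\<Sum>m. kw L a b z m * (z ^ m / fact m))"
      unfolding Kz sums_unique[OF w_sums, symmetric] U[OF assms(4)] by (simp add: algebra_simps)
  qed
  have part2: "ku L a b z (Suc m) = (coeff_a a b m * kA a b m - coeff_b a b m * kB L a b z m) / b"
    "ku L a b z (Suc m) = coeff_a a b m * ku L a b z m + coeff_d a b m * kB L a b z m" for m
    unfolding ku_def rec coeff_d_def using b0 by (simp_all add: field_simps)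
  have v0: "kv b 0 = Gamma (b + 1) * Gamma (2 - b)"
    using Gamma_fact[of 1, where 'a = complex] by (simp add: kv_def)
  show ?thesis
    unfolding K_def [symmetric] C_def [symmetric]
  proof (intro conjI allI)
    show "summable (\<lambda>m. kwd L a b z m * (z ^ m / fact m))"
      using wd_sums by (rule sums_summable)
    show "((\<lambda>\<zeta>. kummerU L a b \<zeta>) has_field_derivative
        K * (\<Sum>m. kwd L a b z m * (z ^ m / fact m))) (at z)"
      using U' by (simp only: sums_unique[OF wd_sums, symmetric])
    fix m
    show "(\<lambda>\<zeta>. ku L a b \<zeta> m) field_differentiable (at z)"
      "(\<lambda>\<zeta>. kw L a b \<zeta> m) field_differentiable (at z)"
      using ku' kw' unfolding field_differentiable_def by blast+
    show "kw' L a b z m = ku' L a b z m / kv b m" "ku' L a b z m = 1 / z * kB L a b z m"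
      by (simp_all only: eq')
    show "ku L a b z (Suc m) = (coeff_a a b m * kA a b m - coeff_b a b m * kB L a b z m) / b"
      "ku L a b z (Suc m) = coeff_a a b m * ku L a b z m + coeff_d a b m * kB L a b z m"
      by (rule part2)+
    show "coeff_d a b m =
        - ((of_nat m)\<^sup>2 + 2 * of_nat m * (a + 1) + 3 * a + 1) + (of_nat m + 2) * b"
      by (rule coeff_d_eq[OF b0])
    show "\<exists>l. ((\<lambda>\<beta>. ku L a \<beta> z m) \<longlongrightarrow> l) (at 0)"
      by (rule ku_limit[OF assms(7)])
  qed (use part1 v0 Gamma_reflection_shifts(3)[OF assms(2)] in blast)+
qed

end
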